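(* Let $q$ be an odd prime power with $q \equiv -1 \pmod 4$ and let $A$ be an integer. Then $$N_{n2}(A) = \begin{cases} N(A) & \text{if } q+1-A \equiv 4 \pmod 8,\\ N(A)/3 & \text{if } q+1-A \equiv 0 \pmod 8.\end{cases}$$
   Context: For $d \in \mathbb{F}_q\setminus\{0,1\}$, $L_d$ denotes the Legendre elliptic curve $y^2 = x(x-1)(x-d)$ over $\mathbb{F}_q$, and $A(d,\mathbb{F}_q) = q+1-\#L_d(\mathbb{F}_q)$. For an integer $A$, $N(A)$ is the number of $d \in \mathbb{F}_q\setminus\{0,1\}$ with $A(d,\mathbb{F}_q)=A$, and $N_{n2}(A)$ is the number of such $d$ that are non-squares in $\mathbb{F}_q$. *)

theory Defs
  imports Complex_Main "HOL-Library.Cardinality" "HOL-Number_Theory.Number_Theory"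
    "HOL-Computational_Algebra.Nth_Powers"
begin

text \<open>
  A finite field \<open>F_q\<close> is a type \<open>'k\<close> of classes \<open>field\<close> and \<open>finite\<close> with \<open>CARD('k) = q\<close>.
  For \<open>d \<noteq> 0, 1\<close> the projective closure of \<open>y\<^sup>2 = x (x - 1) (x - d)\<close> has exactly one point
  at infinity, \<open>(0 : 1 : 0)\<close>; it is represented by \<open>None\<close>.
\<close>

definition legendre_points :: "'k::{field,finite} \<Rightarrow> ('k \<times> 'k) option set" where
  "legendre_points d =
     insert None {Some (x, y) | x y. y ^ 2 = x * (x - 1) * (x - d)}"

definition legendre_trace :: "'k::{field,finite} \<Rightarrow> int" where
  "legendre_trace d = int CARD('k) + 1 - int (card (legendre_points d))"

definition legendre_count :: "'k::{field,finite} itself \<Rightarrow> int \<Rightarrow> nat" where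
  "legendre_count TYPE('k) A =
     card {d :: 'k. d \<noteq> 0 \<and> d \<noteq> 1 \<and> legendre_trace d = A}"

definition legendre_count_nonsquare :: "'k::{field,finite} itself \<Rightarrow> int \<Rightarrow> nat" where
  "legendre_count_nonsquare TYPE('k) A =
     card {d :: 'k. d \<noteq> 0 \<and> d \<noteq> 1 \<and> legendre_trace d = A \<and> \<not> is_square d}"

end

theory Submission
  imports Defs
begin

text \<open>
  Let \<open>f(x) = x (x - 1) (x - d)\<close>. Then \<open>#L_d = 4 + 2n\<close>, where \<open>n\<close> counts the \<open>x\<close> for which
  \<open>f(x)\<close> is a nonzero square. Translation by the three points of order two acts on these \<open>x\<close> as
  the Klein four-group \<open>x \<mapsto> d/x\<close>, \<open>x \<mapsto> (x - d)/(x - 1)\<close>, \<open>x \<mapsto> d (x - 1)/(x - d)\<close>. Since \<open>-1\<close> is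
  not a square, the first map has no fixed point among them; the second has two if \<open>1 - d\<close> is a
  square, the third has two if both \<open>d\<close> and \<open>d - 1\<close> are squares, and there are no others. Hence
  \<open>8\<close> divides \<open>#L_d\<close> iff \<open>d\<close> or \<open>1 - d\<close> is a square, and otherwise \<open>#L_d \<equiv> 4 (mod 8)\<close>.

  This settles the first case. In the second one, the \<open>d\<close> of trace \<open>A\<close> fall into three classes
  according to which of \<open>d\<close>, \<open>1 - d\<close> are squares. The class where both are is in bijection with the
  one where only \<open>d\<close> is by \<open>d \<mapsto> 1/d\<close>, and with the one where only \<open>1 - d\<close> is by
  \<open>d \<mapsto> d/(d - 1)\<close>: these maps preserve the trace when \<open>d\<close>, respectively \<open>1 - d\<close>, is a square.
\<close>

section \<open>Klein four-group actions on finite sets\<close>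

text \<open>Off the fixed points of \<open>t\<close> and \<open>s \<circ> t\<close>, every orbit has
  exactly four elements. All conditions are restricted to \<open>A\<close>, because the fractional
  linear maps used later have poles.\<close>

lemma card_cong_klein_four_fixed:
  fixes s t :: "'a \<Rightarrow> 'a"
  assumes fin: "finite A"
    and s: "\<And>x. x \<in> A \<Longrightarrow> s x \<in> A" "\<And>x. x \<in> A \<Longrightarrow> s (s x) = x"
    and t: "\<And>x. x \<in> A \<Longrightarrow> t x \<in> A" "\<And>x. x \<in> A \<Longrightarrow> t (t x) = x"
    and st: "\<And>x. x \<in> A \<Longrightarrow> s (t x) = t (s x)"
    and free: "\<And>x. x \<in> A \<Longrightarrow> s x \<noteq> x"
  shows "[card A = card {x \<in> A. t x = x \<or> s (t x) = x}] (mod 4)"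
proof -
  define F where "F = {x \<in> A. t x = x \<or> s (t x) = x}"
  define B where "B = A - F"
  define orb where "orb x = {x, s x, t x, s (t x)}" for x
  have B: "x \<in> B \<longleftrightarrow> x \<in> A \<and> t x \<noteq> x \<and> s (t x) \<noteq> x" for x
    by (auto simp: B_def F_def)
  have sB: "s x \<in> B" and tB: "t x \<in> B" if "x \<in> B" for x
    using that s t st unfolding B by metis+
  have orb_card: "card (orb x) = 4" if "x \<in> B" for x
  proof -
    have "x \<noteq> s x" "x \<noteq> t x" "x \<noteq> s (t x)" "s x \<noteq> t x" "s x \<noteq> s (t x)" "t x \<noteq> s (t x)"
      using that s t free unfolding B by metis+
    then show ?thesis by (simp add: orb_def)
  qed
  \<comment> \<open>Closure under \<open>s\<close> and \<open>t\<close> makes any two orbits equal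
    or disjoint, so they partition \<open>B\<close>.\<close>
  have orb_eq: "orb y = orb x" if "x \<in> B" "y \<in> orb x" for x y
  proof -
    have "x \<in> A" "s x \<in> A" "t x \<in> A" "s (t x) \<in> A" using that s t unfolding B by auto
    then have "t (s x) = s (t x)" "t (s (t x)) = s x" "s (s x) = x" "t (t x) = x" "s (s (t x)) = t x"
      using s t st by metis+
    then show ?thesis using that(2) unfolding orb_def by auto
  qed
  have union: "\<Union>(orb ` B) = B"
    using sB tB unfolding orb_def by blast
  have "4 dvd card (\<Union>(orb ` B))"
  proof (rule dvd_partition)
    show "finite (\<Union>(orb ` B))"
      unfolding union using fin by (simp add: B_def)
    show "\<forall>c\<in>orb ` B. 4 dvd card c"
      by (auto simp: orb_card)
    show "\<forall>c1\<in>orb ` B. \<forall>c2\<in>orb ` B. c1 \<noteq> c2 \<longrightarrow> c1 \<inter> c2 = {}"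
      using orb_eq by (metis (no_types, lifting) disjoint_iff imageE)
  qed
  then have "4 dvd card B" by (simp only: union)
  moreover have "card A = card B + card F"
    using fin card_Un_disjoint[of B F] by (auto simp: B_def F_def Un_absorb2)
  ultimately show ?thesis
    unfolding F_def[symmetric] cong_def by (metis dvd_imp_mod_0 mod_add_left_eq add_0)
qed

section \<open>Squares in fields\<close>

lemma is_square_mult_square_iff:
  fixes a c :: "'a::field"
  assumes "c \<noteq> 0"
  shows "is_square (a * c ^ 2) \<longleftrightarrow> is_square a"
proof
  assume "is_square (a * c ^ 2)"
  then obtain y where "a * c ^ 2 = y ^ 2" by (auto elim: is_nth_powerE)
  then have "a = (y / c) ^ 2" using assms by (simp add: field_simps)
  then show "is_square a" by blast
next
  assume "is_square a"
  then show "is_square (a * c ^ 2)" by (simp add: is_nth_power_mult)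
qed

lemma is_square_inverse_iff:
  fixes a :: "'a::field"
  shows "is_square (inverse a) \<longleftrightarrow> is_square a"
proof (cases "a = 0")
  case False
  then show ?thesis using is_square_mult_square_iff[of a "inverse a"]
    by (auto simp: power2_eq_square mult.assoc[symmetric])
qed simp

text \<open>The characteristic divides the cardinality, so it cannot be 2.\<close>

lemma two_neq_zero_if_odd_card:
  assumes "odd CARD('k::{field,finite})"
  shows "(2::'k) \<noteq> 0"
proof
  assume "(2::'k) = 0"
  then have "CHAR('k) dvd 2"
    using of_nat_eq_0_iff_char_dvd[of 2, where 'a = 'k] by simp
  then have "CHAR('k) = 2"
    using prime_nat_iff[of 2] by auto
  then show False
    using CHAR_dvd_CARD[where 'a = 'k] assms by simp
qed

definition legendre_cubic :: "'a::field \<Rightarrow> 'a \<Rightarrow> 'a" where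
  "legendre_cubic d x = x * (x - 1) * (x - d)"

text \<open>These are the abscissae carrying two points each; the roots of the cubic, which carry
  the points of order two, are left out.\<close>

definition square_values :: "'a::field \<Rightarrow> 'a set" where
  "square_values d = {x. legendre_cubic d x \<noteq> 0 \<and> is_square (legendre_cubic d x)}"

section \<open>Squares in a finite field of order 3 modulo 4\<close>

context
  assumes card3: "CARD('k::{field,finite}) mod 4 = 3"
begin

lemma two_neq_zero: "(2::'k) \<noteq> 0"
  using card3 by (intro two_neq_zero_if_odd_card) presburger

lemma minus_neq_self: "- x \<noteq> x" if "x \<noteq> 0" for x :: 'k
  using two_neq_zero that by (metis add_eq_0_iff mult_2 mult_eq_0_iff)

text \<open>The Klein four-group \<open>x \<mapsto> \<plusminus>x, \<plusminus>1/x\<close> acts on the units; a square root of \<open>-1\<close>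
  would contribute two more fixed points besides \<open>\<plusminus>1\<close>.\<close>

lemma minus_one_nonsquare: "\<not> is_square (-1 :: 'k)"
proof
  assume "is_square (-1 :: 'k)"
  then obtain i :: 'k where i: "i ^ 2 = -1" by (metis is_nth_powerE)
  have i0: "i \<noteq> 0" using i by auto
  have "[card (-{0::'k}) = card {x \<in> -{0::'k}. inverse x = x \<or> - inverse x = x}] (mod 4)"
    by (rule card_cong_klein_four_fixed) (auto simp: minus_neq_self)
  also have "{x \<in> -{0::'k}. inverse x = x \<or> - inverse x = x} = {1, -1, i, -i}"
  proof (intro Set.set_eqI)
    fix x :: 'k
    show "x \<in> {x \<in> -{0::'k}. inverse x = x \<or> - inverse x = x} \<longleftrightarrow> x \<in> {1, -1, i, -i}"
    proof (cases "x = 0")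
      case False
      then have "inverse x = x \<longleftrightarrow> x ^ 2 = 1 ^ 2" "- inverse x = x \<longleftrightarrow> x ^ 2 = i ^ 2"
        unfolding i by (auto simp: field_simps power2_eq_square)
      then show ?thesis using False by (auto simp: power2_eq_iff power2_eq_1_iff)
    qed (use i0 in auto)
  qed
  also have "card {1, -1, i, -i} = 4"
  proof -
    have "i \<noteq> 1" "i \<noteq> -1" using i minus_neq_self[of 1] by auto
    moreover have "-i \<noteq> 1" "-i \<noteq> -1" using calculation by (metis minus_minus)+
    ultimately show ?thesis using minus_neq_self[of 1] minus_neq_self[OF i0] by (auto simp: card_insert_if)
  qed
  also have "card (-{0::'k}) = CARD('k) - 1"
    by (simp add: card_Diff_subset Compl_eq_Diff_UNIV)
  \<comment> \<open>The number of units is 2 modulo 4, but the fixed points number 4.\<close>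
  finally show False
    using card3 unfolding cong_def by presburger
qed

text \<open>The quotient of the two roots would be a square root of -1.\<close>

lemma not_square_both: "\<not> (is_square x \<and> is_square (- x))" if "x \<noteq> 0" for x :: 'k
proof
  assume "is_square x \<and> is_square (- x)"
  then obtain y z where "x = y ^ 2" "- x = z ^ 2" by (auto elim!: is_nth_powerE)
  then have "(z / y) ^ 2 = -1" using that by (simp add: field_simps)
  then show False using minus_one_nonsquare by (metis is_nth_power_nth_power)
qed

lemma card_square_roots: "card {y :: 'k. y ^ 2 = x} = 2" if "x \<noteq> 0" and square: "is_square x" for x :: 'k
proof -
  obtain y where y: "x = y ^ 2" using square by (rule is_nth_powerE)
  then have "{z. z ^ 2 = x} = {y, - y}" by (auto simp: power2_eq_iff)
  moreover have "- y \<noteq> y" using y that by (intro minus_neq_self) auto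
  ultimately show ?thesis by (simp add: card_insert_if)
qed

text \<open>Squaring is two-to-one on the units, so the nonzero squares and their negatives,
  which are disjoint, already exhaust the units.\<close>

lemma is_square_minus: "is_square (- x)" if "\<not> is_square x" for x :: 'k
proof -
  define S where "S = {x :: 'k. x \<noteq> 0 \<and> is_square x}"
  have "-{0::'k} = (\<Union>x\<in>S. {y. y ^ 2 = x})" by (auto simp: S_def)
  also have "card \<dots> = (\<Sum>x\<in>S. card {y. y ^ 2 = x})"
    by (rule card_UN_disjoint) auto
  also have "\<dots> = 2 * card S"
    using card_square_roots by (simp add: S_def)
  finally have 1: "card (-{0::'k}) = 2 * card S" .
  have "card (S \<union> uminus ` S) = card S + card (uminus ` S)"
    using not_square_both by (intro card_Un_disjoint) (auto simp: S_def)
  also have "\<dots> = 2 * card S" by (simp add: card_image)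
  finally have "S \<union> uminus ` S = -{0}"
    using 1 by (intro card_subset_eq) (auto simp: S_def)
  moreover have "x \<noteq> 0" using that by auto
  ultimately have "x \<in> S \<union> uminus ` S" by blast
  then show ?thesis using that by (auto simp: S_def)
qed

lemma is_square_minus_iff: "is_square (- x) \<longleftrightarrow> \<not> is_square x" if "x \<noteq> 0" for x :: 'k
  using is_square_minus not_square_both that by blast

lemma is_square_mult_iff: "is_square (x * y) \<longleftrightarrow> (is_square x \<longleftrightarrow> is_square y)"
  if "x \<noteq> 0" "y \<noteq> 0" for x y :: 'k
proof -
  have "is_square (a * b) = is_square b" if square: "is_square a" and "a \<noteq> 0" for a b :: 'k
  proof -
    obtain c where "a = c ^ 2" using square by (rule is_nth_powerE)
    then show ?thesis using is_square_mult_square_iff[of c b] that by (auto simp: mult.commute)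
  qed
  \<comment> \<open>One of \<open>x\<close> and \<open>- x\<close> is a square, so the case of a
    square first factor suffices; a sign flips squareness on both sides.\<close>
  from this[of x y] this[of "- x" y] show ?thesis
    using that is_square_minus_iff[of x] is_square_minus_iff[of "x * y"] by auto
qed


section \<open>Point counts of Legendre curves\<close>

lemma card_legendre_points:
  "card (legendre_points d) = Suc (card {(x, y). y ^ 2 = legendre_cubic d x})"
  for d :: 'k
proof -
  have "legendre_points d = insert None (Some ` {(x, y). y ^ 2 = legendre_cubic d x})"
    by (auto simp: legendre_points_def legendre_cubic_def)
  then show ?thesis by (simp add: card_image)
qed

text \<open>The summand 4 is the point at infinity plus the three points with \<open>y = 0\<close>;
  every other abscissa contributes two points or none.\<close>

lemma card_legendre_points_eq:
  fixes d :: 'k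
  assumes d: "d \<noteq> 0" "d \<noteq> 1"
  shows "card (legendre_points d) = 4 + 2 * card (square_values d)"
proof -
  let ?R = "SIGMA x:square_values d. {y. y ^ 2 = legendre_cubic d x}"
  have "{(x, y). y ^ 2 = legendre_cubic d x} = {0, 1, d} \<times> {0} \<union> ?R"
    by (auto simp: square_values_def legendre_cubic_def intro: is_nth_powerI[OF sym])
  also have "card \<dots> = card ({0, 1, d} \<times> {0 :: 'k}) + card ?R"
    by (rule card_Un_disjoint) (auto simp: square_values_def legendre_cubic_def)
  also have "card ({0, 1, d} \<times> {0 :: 'k}) = 3"
    using d by (simp add: card_cartesian_product card_insert_if)
  also have "card ?R = 2 * card (square_values d)"
    using card_square_roots by (simp add: card_SigmaI square_values_def)
  finally show ?thesis by (simp add: card_legendre_points)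
qed

section \<open>Changes of parameter that preserve the trace\<close>

text \<open>Dividing the cubic by \<open>m ^ 3\<close> amounts to dividing \<open>y\<close> by
  \<open>e ^ 3\<close> with \<open>e ^ 2 = m\<close>; this is where \<open>m\<close> has to be a
  square.\<close>

lemma card_legendre_points_affine:
  fixes d d' c m :: 'k
  assumes m: "m \<noteq> 0" "is_square m"
    and cubic: "\<And>x. legendre_cubic d' ((x - c) / m) = legendre_cubic d x / m ^ 3"
  shows "card (legendre_points d') = card (legendre_points d)"
proof -
  obtain e where e: "m = e ^ 2" using m(2) by (rule is_nth_powerE)
  then have e0: "e \<noteq> 0" using m by auto
  have "bij_betw (\<lambda>(x, y). ((x - c) / m, y / e ^ 3))
     {(x, y). y ^ 2 = legendre_cubic d x} {(x, y). y ^ 2 = legendre_cubic d' x}"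
  proof (rule bij_betwI[where g = "\<lambda>(x, y). (m * x + c, y * e ^ 3)"])
    show "(\<lambda>(x, y). ((x - c) / m, y / e ^ 3)) \<in>
      {(x, y). y ^ 2 = legendre_cubic d x} \<rightarrow> {(x, y). y ^ 2 = legendre_cubic d' x}"
      using cubic by (auto simp: e power_divide simp flip: power_mult)
    have "legendre_cubic d (m * x + c) = legendre_cubic d' x * m ^ 3" for x
      using cubic[of "m * x + c"] m(1) by simp
    then show "(\<lambda>(x, y). (m * x + c, y * e ^ 3)) \<in>
      {(x, y). y ^ 2 = legendre_cubic d' x} \<rightarrow> {(x, y). y ^ 2 = legendre_cubic d x}"
      by (auto simp: e power_mult_distrib simp flip: power_mult)
  qed (use m e0 in auto)
  then show ?thesis by (simp add: card_legendre_points bij_betw_same_card)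
qed

text \<open>Division by \<open>d\<close> carries the roots 0, 1, \<open>d\<close> to 0,
  \<open>inverse d\<close>, 1.\<close>

lemma legendre_trace_inverse:
  fixes d :: 'k
  assumes "d \<noteq> 0" "is_square d"
  shows "legendre_trace (inverse d) = legendre_trace d"
proof -
  have "card (legendre_points (inverse d)) = card (legendre_points d)"
    using assms
    by (intro card_legendre_points_affine[where m = d and c = 0])
       (auto simp: legendre_cubic_def field_simps power3_eq_cube)
  then show ?thesis by (simp add: legendre_trace_def)
qed

text \<open>The map \<open>x \<mapsto> (x - d) / (1 - d)\<close> carries the roots \<open>d\<close>,
  1, 0 to 0, 1, \<open>d / (d - 1)\<close>.\<close>

lemma legendre_trace_divide:
  fixes d :: 'k
  assumes "d \<noteq> 1" "is_square (1 - d)"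
  shows "legendre_trace (d / (d - 1)) = legendre_trace d"
proof -
  have "legendre_cubic (d / (d - 1)) ((x - d) / (1 - d)) = legendre_cubic d x / (1 - d) ^ 3" for x
  proof -
    have d: "1 - d \<noteq> 0" using assms by simp
    have "(x - d) / (1 - d) - 1 = (x - 1) / (1 - d)"
      using d by (simp add: field_simps)
    moreover have "(x - d) / (1 - d) - d / (d - 1) = x / (1 - d)"
      using d minus_divide_right[of d "1 - d"] by (simp add: diff_divide_distrib)
    ultimately show ?thesis by (simp add: legendre_cubic_def power3_eq_cube mult_ac)
  qed
  then have "card (legendre_points (d / (d - 1))) = card (legendre_points d)"
    using assms by (intro card_legendre_points_affine[where m = "1 - d" and c = d]) auto
  then show ?thesis by (simp add: legendre_trace_def)
qed

section \<open>The point count modulo 8\<close>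

lemma card_square_values_mod_4:
  fixes d :: 'k
  assumes d: "d \<noteq> 0" "d \<noteq> 1"
  shows "[card (square_values d) = (if is_square d \<or> is_square (1 - d) then 2 else 0)] (mod 4)"
proof -
  let ?A = "square_values d"
  let ?s = "\<lambda>x. d / x" and ?t = "\<lambda>x. (x - d) / (x - 1)"
  have A_iff: "x \<in> ?A \<longleftrightarrow> x \<noteq> 0 \<and> x \<noteq> 1 \<and> x \<noteq> d \<and> is_square (legendre_cubic d x)" for x
    by (auto simp: square_values_def legendre_cubic_def)
  have A: "x \<noteq> 0" "x - 1 \<noteq> 0" "x - d \<noteq> 0" "x \<noteq> 1" "x \<noteq> d" if "x \<in> ?A" for x
    using that by (auto simp: A_iff)
  have d1: "1 - d \<noteq> 0" "d - 1 \<noteq> 0" using d by auto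
  have sA: "?s x \<in> ?A" if x: "x \<in> ?A" for x
  proof -
    \<comment> \<open>Translation by a point of order two multiplies the cubic by a nonzero square;
      the same happens for \<open>?t\<close> below.\<close>
    have "legendre_cubic d (?s x) = legendre_cubic d x * (d / x ^ 2) ^ 2"
      using A[OF x] by (simp add: legendre_cubic_def field_simps power2_eq_square)
    then show ?thesis
      using x A[OF x] d is_square_mult_square_iff[of "d / x ^ 2" "legendre_cubic d x"]
      by (simp add: square_values_def)
  qed
  have tA: "?t x \<in> ?A" if x: "x \<in> ?A" for x
  proof -
    have "?t x - 1 = (1 - d) / (x - 1)" "?t x - d = x * (1 - d) / (x - 1)"
      using A[OF x] by (simp_all add: field_simps)
    then have "legendre_cubic d (?t x) = (x - d) / (x - 1) * ((1 - d) / (x - 1)) * (x * (1 - d) / (x - 1))"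
      by (simp add: legendre_cubic_def)
    also have "\<dots> = legendre_cubic d x * ((1 - d) / (x - 1) ^ 2) ^ 2"
      using A[OF x] by (simp add: legendre_cubic_def power2_eq_square divide_simps)
    finally show ?thesis
      using x A[OF x] d is_square_mult_square_iff[of "(1 - d) / (x - 1) ^ 2" "legendre_cubic d x"]
      by (simp add: square_values_def)
  qed
  have tt: "?t (?t x) = x" if x: "x \<in> ?A" for x
  proof -
    have "?t x - d = x * (1 - d) / (x - 1)" "?t x - 1 = (1 - d) / (x - 1)"
      using A[OF x] by (simp_all add: field_simps)
    then show ?thesis using A[OF x] d1 by simp
  qed
  have ts: "?s (?t x) = ?t (?s x)" if x: "x \<in> ?A" for x
  proof -
    have "d - x \<noteq> 0" using A[OF x] by auto
    moreover have "?s x - d = d * (1 - x) / x" "?s x - 1 = (d - x) / x"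
      using A[OF x] by (simp_all add: field_simps)
    ultimately show ?thesis using A[OF x] by (simp add: divide_simps) (simp add: algebra_simps)
  qed
  have s_free: "?s x \<noteq> x" if x: "x \<in> ?A" for x
  proof
    assume "?s x = x"
    then have "d = x ^ 2" using A[OF x] by (simp add: field_simps power2_eq_square)
    \<comment> \<open>For \<open>d = x ^ 2\<close> the last factor of the cubic is
      \<open>- x * (x - 1)\<close>.\<close>
    then have "legendre_cubic d x = - 1 * (x * (x - 1)) ^ 2"
      by (simp add: legendre_cubic_def power2_eq_square algebra_simps)
    then show False
      using x A[OF x] is_square_mult_square_iff[of "x * (x - 1)" "- 1 :: 'k"] minus_one_nonsquare
      by (simp add: A_iff)
  qed
  define F where "F = {x \<in> ?A. ?t x = x \<or> ?s (?t x) = x}"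
  have "[card ?A = card F] (mod 4)"
    unfolding F_def
    by (rule card_cong_klein_four_fixed) (use d sA tA tt ts s_free in \<open>auto simp: A\<close>)
  moreover have "card F = (if is_square d \<or> is_square (1 - d) then 2 else 0)"
  proof -
    have t_fix: "?t x = x \<longleftrightarrow> (x - 1) ^ 2 = 1 - d" if "x \<in> ?A" for x
      using A[OF that] by (auto simp: field_simps power2_eq_square)
    have st_fix: "?s (?t x) = x \<longleftrightarrow> (x - d) ^ 2 = d * (d - 1)" if "x \<in> ?A" for x
      using A[OF that] by (auto simp: field_simps power2_eq_square)
    \<comment> \<open>Every root of the fixed-point equation of \<open>?t\<close> already lies in
      \<open>?A\<close>, since there \<open>x - d = x * (x - 1)\<close> turns the cubic into a
      square.\<close>
    have t_in: "x \<in> ?A" if x: "(x - 1) ^ 2 = 1 - d" for x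
    proof -
      have "x \<noteq> 0" "x \<noteq> 1" using d x by (auto simp: power2_eq_square)
      moreover have xd: "x - d = x * (x - 1)" using x by (simp add: algebra_simps power2_eq_square)
      moreover have "x \<noteq> d" using calculation by auto
      moreover from xd have "legendre_cubic d x = (x * (x - 1)) ^ 2" by (simp add: legendre_cubic_def power2_eq_square)
      ultimately show ?thesis by (auto simp: A_iff)
    qed
    \<comment> \<open>For \<open>?s \<circ> ?t\<close> only \<open>d\<close> times the cubic becomes
      a square, so membership depends on \<open>d\<close>.\<close>
    have st_in: "x \<in> ?A \<longleftrightarrow> is_square d" if x: "(x - d) ^ 2 = d * (d - 1)" for x
    proof -
      have x0: "x \<noteq> 0" "x \<noteq> 1" "x \<noteq> d" using d x by (auto simp: power2_eq_square algebra_simps)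
      have "d * (x - 1) = x * (x - d)" using x by (simp add: algebra_simps power2_eq_square)
      then have "d * legendre_cubic d x = (x * (x - d)) ^ 2" by (simp add: legendre_cubic_def power2_eq_square)
      then have "is_square (d * legendre_cubic d x)" by simp
      then show ?thesis using is_square_mult_iff[of d "legendre_cubic d x"] x0 d
        by (auto simp: A_iff legendre_cubic_def)
    qed
    have F: "x \<in> F \<longleftrightarrow> (x - 1) ^ 2 = 1 - d \<or> is_square d \<and> (x - d) ^ 2 = d * (d - 1)" for x
      unfolding F_def using t_fix st_fix t_in st_in by blast
    have d_swap: "is_square (1 - d) \<longleftrightarrow> \<not> is_square (d - 1)"
      using is_square_minus_iff[of "d - 1"] d1 by simp
    \<comment> \<open>The two kinds of fixed points never coexist: if \<open>d\<close> and
      \<open>1 - d\<close> are squares, \<open>d * (d - 1)\<close> is not.\<close>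
    have no_st: "\<not> (is_square d \<and> (x - d) ^ 2 = d * (d - 1))" if "is_square (1 - d)" for x
    proof
      assume *: "is_square d \<and> (x - d) ^ 2 = d * (d - 1)"
      then have "is_square (d * (d - 1))" by (metis is_nth_power_nth_power)
      then show False using * that d_swap is_square_mult_iff[of d "d - 1"] d d1 by simp
    qed
    have shift: "card {x. (x - c) ^ 2 = a} = card {y :: 'k. y ^ 2 = a}" for a c :: 'k
      by (rule bij_betw_same_card[of "\<lambda>x. x - c"], rule bij_betwI[where g = "\<lambda>y. y + c"]) auto
    consider "is_square (1 - d)" | "\<not> is_square (1 - d)" "is_square d"
      | "\<not> is_square (1 - d)" "\<not> is_square d" by blast
    then show ?thesis
    proof cases
      case 1
      then have "F = {x. (x - 1) ^ 2 = 1 - d}" using F no_st by blast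
      then show ?thesis using 1 d1 by (simp add: shift card_square_roots)
    next
      case 2
      then have "(x - 1) ^ 2 \<noteq> 1 - d" for x by (metis is_nth_power_nth_power)
      then have "F = {x. (x - d) ^ 2 = d * (d - 1)}" using F 2 by blast
      moreover have "is_square (d * (d - 1))"
        using 2 d d1 d_swap by (simp add: is_square_mult_iff)
      ultimately show ?thesis using 2 d d1 by (simp add: shift card_square_roots)
    next
      case 3
      then have "(x - 1) ^ 2 \<noteq> 1 - d" for x by (metis is_nth_power_nth_power)
      then have "F = {}" using F 3 by blast
      then show ?thesis using 3 by simp
    qed
  qed
  ultimately show ?thesis by simp
qed

text \<open>In \<open>4 + 2 * n\<close>, the residues 2 and 0 of \<open>n\<close> modulo 4 give 0
  and 4 modulo 8.\<close>

lemma card_legendre_points_mod_8: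
  fixes d :: 'k
  assumes d: "d \<noteq> 0" "d \<noteq> 1"
  shows "[card (legendre_points d) = (if is_square d \<or> is_square (1 - d) then 0 else 4)] (mod 8)"
proof (cases "is_square d \<or> is_square (1 - d)")
  case True
  show ?thesis
    using card_square_values_mod_4[OF d] card_legendre_points_eq[OF d]
    unfolding cong_def if_P[OF True] by presburger
next
  case False
  show ?thesis
    using card_square_values_mod_4[OF d] card_legendre_points_eq[OF d]
    unfolding cong_def if_not_P[OF False] by presburger
qed

section \<open>The three classes of parameters\<close>

text \<open>The factor -1 in \<open>1 - inverse d = - (1 - d) * inverse d\<close> flips squareness,
  so inversion exchanges two of the classes.\<close>

lemma is_square_one_minus_inverse:
  fixes d :: 'k
  assumes "d \<noteq> 0" "d \<noteq> 1" "is_square d"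
  shows "is_square (1 - inverse d) \<longleftrightarrow> \<not> is_square (1 - d)"
proof -
  have "1 - inverse d = - (1 - d) * inverse d"
    using assms by (simp add: field_simps)
  then show ?thesis
    using assms is_square_mult_iff[of "- (1 - d)" "inverse d"] is_square_minus_iff[of "1 - d"]
    by (simp add: is_square_inverse_iff)
qed

text \<open>Here \<open>d / (d - 1)\<close> acquires a factor -1 and
  \<open>1 - d / (d - 1) = inverse (1 - d)\<close> does not, so only the squareness of
  \<open>d\<close> flips.\<close>

lemma is_square_divide_minus_one:
  fixes d :: 'k
  assumes "d \<noteq> 0" "d \<noteq> 1" "is_square (1 - d)"
  shows "is_square (d / (d - 1)) \<longleftrightarrow> \<not> is_square d"
    and "is_square (1 - d / (d - 1))"
proof -
  have "d / (d - 1) = - d * inverse (1 - d)" "1 - d / (d - 1) = inverse (1 - d)"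
    using assms by (simp_all add: field_simps)
  then show "is_square (d / (d - 1)) \<longleftrightarrow> \<not> is_square d" "is_square (1 - d / (d - 1))"
    using assms is_square_mult_iff[of "- d" "inverse (1 - d)"] is_square_minus_iff[of d]
    by (simp_all add: is_square_inverse_iff)
qed

lemma card_eq_involution:
  assumes "\<And>x. x \<in> X \<Longrightarrow> f x \<in> Y \<and> f (f x) = x"
    and "\<And>y. y \<in> Y \<Longrightarrow> f y \<in> X \<and> f (f y) = y"
  shows "card X = card Y"
  using assms by (intro bij_betw_same_card[of f] bij_betwI[where g = f]) auto

text \<open>The second claim is written as a product to stay within the natural numbers.\<close>

lemma legendre_counts:
  shows "[int CARD('k) + 1 - A = 4] (mod 8) \<Longrightarrow>
      legendre_count_nonsquare TYPE('k) A = legendre_count TYPE('k) A"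
    and "[int CARD('k) + 1 - A = 0] (mod 8) \<Longrightarrow>
      legendre_count TYPE('k) A = 3 * legendre_count_nonsquare TYPE('k) A"
proof -
  define T where "T = {d :: 'k. d \<noteq> 0 \<and> d \<noteq> 1 \<and> legendre_trace d = A}"
  have count: "legendre_count TYPE('k) A = card T"
    "legendre_count_nonsquare TYPE('k) A = card {d \<in> T. \<not> is_square d}"
    unfolding legendre_count_def legendre_count_nonsquare_def T_def
    by (auto intro!: arg_cong[where f = card])
  have T: "[int CARD('k) + 1 - A = (if is_square d \<or> is_square (1 - d) then 0 else 4)] (mod 8)"
    if "d \<in> T" for d
  proof -
    have "int CARD('k) + 1 - A = int (card (legendre_points d))" "d \<noteq> 0" "d \<noteq> 1"
      using that by (auto simp: T_def legendre_trace_def)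
    then show ?thesis
      using card_legendre_points_mod_8[of d]
      by (cases "is_square d \<or> is_square (1 - d)") (auto simp flip: cong_int_iff)
  qed
  {
    assume "[int CARD('k) + 1 - A = 4] (mod 8)"
    \<comment> \<open>A square \<open>d\<close> would force the residue 0 instead of 4.\<close>
    then have "{d \<in> T. \<not> is_square d} = T"
      by (auto simp: cong_def split: if_splits dest: T)
    then show "legendre_count_nonsquare TYPE('k) A = legendre_count TYPE('k) A"
      by (simp add: count)
  next
    assume "[int CARD('k) + 1 - A = 0] (mod 8)"
    then have sq: "is_square d \<or> is_square (1 - d)" if "d \<in> T" for d
      using T[OF that] by (auto simp: cong_def split: if_splits)
    define U where "U = {d \<in> T. is_square d \<and> is_square (1 - d)}"
    define V where "V = {d \<in> T. is_square d \<and> \<not> is_square (1 - d)}"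
    define W where "W = {d \<in> T. \<not> is_square d}"
    \<comment> \<open>Residue 0 rules out that \<open>d\<close> and \<open>1 - d\<close> are both
      nonsquares, so \<open>W\<close> is exactly the third class.\<close>
    have W: "d \<in> W \<longleftrightarrow> d \<in> T \<and> \<not> is_square d \<and> is_square (1 - d)" for d
      using sq by (auto simp: W_def)
    have "card U = card V"
      by (rule card_eq_involution[where f = inverse])
         (auto simp: U_def V_def T_def legendre_trace_inverse is_square_inverse_iff
            is_square_one_minus_inverse)
    moreover have "card U = card W"
    proof (rule card_eq_involution[where f = "\<lambda>d. d / (d - 1)"])
      \<comment> \<open>Both \<open>U\<close> and \<open>W\<close> require \<open>1 - d\<close> to
        be a square, so this serves both directions.\<close>
      have 1: "d / (d - 1) \<in> T" "d / (d - 1) / (d / (d - 1) - 1) = d"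
        if "d \<in> T" "is_square (1 - d)" for d
      proof -
        have "d / (d - 1) - 1 = 1 / (d - 1)" "d - 1 \<noteq> 0"
          using that by (auto simp: T_def field_simps)
        then show "d / (d - 1) \<in> T" "d / (d - 1) / (d / (d - 1) - 1) = d"
          using that by (auto simp: T_def legendre_trace_divide)
      qed
      show "d / (d - 1) \<in> W \<and> d / (d - 1) / (d / (d - 1) - 1) = d" if "d \<in> U" for d
        using that 1[of d] is_square_divide_minus_one[of d] unfolding W
        by (auto simp: U_def T_def)
      show "d / (d - 1) \<in> U \<and> d / (d - 1) / (d / (d - 1) - 1) = d" if "d \<in> W" for d
        using that 1[of d] is_square_divide_minus_one[of d] unfolding W
        by (auto simp: U_def T_def)
    qed
    moreover have "card T = card U + card V + card W"
    proof -
      have "T = U \<union> V \<union> W" by (auto simp: U_def V_def W_def)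
      also have "card \<dots> = card (U \<union> V) + card W"
        by (rule card_Un_disjoint) (auto simp: U_def V_def W_def)
      also have "card (U \<union> V) = card U + card V"
        by (rule card_Un_disjoint) (auto simp: U_def V_def)
      finally show ?thesis .
    qed
    ultimately show "legendre_count TYPE('k) A = 3 * legendre_count_nonsquare TYPE('k) A"
      by (simp add: count flip: W_def)
  }
qed

end

theorem theorem6p7:
  fixes q :: nat and A :: int
  assumes "primepow q" and "odd q" and "[int q = - 1] (mod 4)"
    and "CARD('k::{field,finite}) = q"
  shows "([int q + 1 - A = 4] (mod 8) \<longrightarrow>
            legendre_count_nonsquare TYPE('k) A = legendre_count TYPE('k) A) \<and>
         ([int q + 1 - A = 0] (mod 8) \<longrightarrow>
            real (legendre_count_nonsquare TYPE('k) A) = real (legendre_count TYPE('k) A) / 3)"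
proof -
  have "CARD('k) mod 4 = 3"
    using assms(3,4) unfolding cong_def by presburger
  from legendre_counts[OF this, of A] show ?thesis
    using assms(4) by simp
qed

end
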